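(* Let $k$ be a positive integer. Then, in $\mathcal A$, $$T_{\mathcal A}(\{1\}^k)=-\zeta_{\mathcal A}(\overline{k})=\begin{cases}0,&k\text{ even},\\2\,\mathtt q_2,&k=1,\\2(1-2^{1-k})\beta_k,&k\text{ odd and }k\ge3.\end{cases}$$
   Context: Let $\mathcal P$ be the set of primes and $\mathcal A=\prod_{p\in\mathcal P}(\mathbb Z/p\mathbb Z)\big/\bigoplus_{p\in\mathcal P}(\mathbb Z/p\mathbb Z)$, a $\mathbb Q$-algebra; two elements are equal iff their components agree for all but finitely many $p$, so components at finitely many primes may be left unspecified. $\{1\}^k$ denotes the string $1,\dots,1$ of length $k$. For positive integers $s_1,\dots,s_d$, $T_{\mathcal A}(s_1,\dots,s_d)\in\mathcal A$ is the class of $$\Big(\sum_{\substack{p>n_1>\dots>n_d>0\\ n_j\equiv d-j+1 \ (\mathrm{mod}\ 2)}}\frac{2^d}{n_1^{s_1}\cdots n_d^{s_d}} \bmod p\Big)_{p\in\mathcal P}.$$ Also $\zeta_{\mathcal A}(\overline{k})=\big(\sum_{n=1}^{p-1}\frac{(-1)^n}{n^k}\bmod p\big)_{p\in\mathcal P}$; $\mathtt q_2=\big(\frac{2^{p-1}-1}{p}\bmod p\big)_{p>2}$ is the Fermat quotient; and $\beta_k=\big(\frac{B_{p-k}}{k}\bmod p\big)_{p>k}$, where the Bernoulli numbers are defined by $\frac{t}{e^t-1}=\sum_{n\ge0}B_n\frac{t^n}{n!}$. *)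

theory Defs
  imports
    "HOL-Number_Theory.Number_Theory"
    "HOL-Computational_Algebra.Formal_Power_Series"
begin

section \<open>Residue classes modulo all but finitely many primes\<close>

text \<open>
  An element of the product of all \<open>\<int>/p\<int>\<close> is represented by an integer sequence whose \<open>p\<close>-th entry
  stands for its residue class modulo \<open>p\<close>; entries at non-prime positions are ignored.
  Since the direct sum consists of the families with finitely many nonzero components, two
  sequences represent the same element of the quotient iff they are congruent modulo \<open>p\<close> for all
  but finitely many primes \<open>p\<close>.
\<close>

definition adele_rel :: "(nat \<Rightarrow> int) \<Rightarrow> (nat \<Rightarrow> int) \<Rightarrow> bool" where
  "adele_rel x y \<longleftrightarrow> finite {p. prime p \<and> \<not> [x p = y p] (mod int p)}"

lemma adele_rel_refl: "adele_rel x x"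
  by (simp add: adele_rel_def)

lemma adele_rel_sym: "adele_rel x y \<Longrightarrow> adele_rel y x"
  by (simp add: adele_rel_def cong_sym_eq)

lemma adele_rel_trans:
  assumes "adele_rel x y" "adele_rel y z"
  shows   "adele_rel x z"
proof -
  have "{p. prime p \<and> \<not> [x p = z p] (mod int p)} \<subseteq>
          {p. prime p \<and> \<not> [x p = y p] (mod int p)} \<union> {p. prime p \<and> \<not> [y p = z p] (mod int p)}"
    unfolding cong_def by force
  thus ?thesis
    using assms unfolding adele_rel_def by (meson finite_Un finite_subset)
qed

quotient_type adele = "nat \<Rightarrow> int" / adele_rel
proof (rule equivpI)
  show "reflp adele_rel"
    by (rule reflpI) (rule adele_rel_refl)
  show "symp adele_rel"
    by (rule sympI) (rule adele_rel_sym)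
  show "transp adele_rel"
    by (rule transpI) (rule adele_rel_trans)
qed

lemma adele_rel_lift2:
  assumes f: "\<And>p. [x p = x' p] (mod int p) \<Longrightarrow> [y p = y' p] (mod int p) \<Longrightarrow>
                [f (x p) (y p) = f (x' p) (y' p)] (mod int p)"
  assumes "adele_rel x x'" "adele_rel y y'"
  shows   "adele_rel (\<lambda>p. f (x p) (y p)) (\<lambda>p. f (x' p) (y' p))"
proof -
  have "{p. prime p \<and> \<not> [f (x p) (y p) = f (x' p) (y' p)] (mod int p)} \<subseteq>
          {p. prime p \<and> \<not> [x p = x' p] (mod int p)} \<union> {p. prime p \<and> \<not> [y p = y' p] (mod int p)}"
    using f by blast
  thus ?thesis
    using assms(2,3) unfolding adele_rel_def by (meson finite_Un finite_subset)
qed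

instantiation adele :: comm_ring_1
begin

lift_definition zero_adele :: adele is "\<lambda>_. 0" .

lift_definition one_adele :: adele is "\<lambda>_. 1" .

lift_definition plus_adele :: "adele \<Rightarrow> adele \<Rightarrow> adele" is "\<lambda>x y p. x p + y p"
  by (rule adele_rel_lift2) (auto intro: cong_add)

lift_definition minus_adele :: "adele \<Rightarrow> adele \<Rightarrow> adele" is "\<lambda>x y p. x p - y p"
  by (rule adele_rel_lift2) (auto intro: cong_diff)

lift_definition times_adele :: "adele \<Rightarrow> adele \<Rightarrow> adele" is "\<lambda>x y p. x p * y p"
  by (rule adele_rel_lift2) (auto intro: cong_mult)

lift_definition uminus_adele :: "adele \<Rightarrow> adele" is "\<lambda>x p. - x p"
  by (simp add: adele_rel_def cong_minus_minus_iff)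

instance
proof
  show "(0 :: adele) \<noteq> 1"
  proof (transfer, rule notI)
    assume "adele_rel (\<lambda>_. 0) (\<lambda>_. 1)"
    moreover have "{p. prime p \<and> \<not> [0 = 1] (mod int p)} = {p. prime p}"
      by (auto simp: cong_def dest: prime_gt_1_nat)
    ultimately show False
      using primes_infinite by (simp add: adele_rel_def)
  qed
qed (transfer; simp add: adele_rel_refl algebra_simps)+

end


section \<open>Reduction of rational numbers\<close>

text \<open>
  The residue of \<open>a / b\<close> modulo a prime \<open>p\<close> is \<open>a b\<^sup>-\<^sup>1\<close>, which makes sense if \<open>p\<close> does not divide
  the denominator in lowest terms. Otherwise the value is \<open>0\<close> and has no meaning.
\<close>

definition rat_residue :: "nat \<Rightarrow> rat \<Rightarrow> int" where
  "rat_residue p x =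
     (let (a, b) = quotient_of x in (a * modular_inverse (int p) b) mod int p)"

lemma rat_residue_cong:
  assumes "prime p" "b \<noteq> 0" "\<not> int p dvd b"
  shows   "[rat_residue p (of_int a / of_int b) * b = a] (mod int p)"
proof -
  obtain a' b' where q: "quotient_of (of_int a / of_int b) = (a', b')"
    by fastforce
  have b': "b' > 0"
    using q by (rule quotient_of_denom_pos)
  have "(of_int a / of_int b :: rat) = of_int a' / of_int b'"
    using q by (rule quotient_of_div)
  hence "of_int (a * b') = (of_int (a' * b) :: rat)"
    using b' assms(2) by (simp add: field_simps)
  hence eq: "a * b' = a' * b"
    by (simp only: of_int_eq_iff)
  have "b' dvd a' * b"
    using eq by (metis dvd_triv_right)
  hence "b' dvd b"
    using quotient_of_coprime[OF q] by (metis coprime_commute coprime_dvd_mult_right_iff)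
  hence "\<not> int p dvd b'"
    using assms(3) dvd_trans by blast
  hence cop: "coprime b' (int p)"
    using assms(1) prime_imp_coprime[of "int p" b'] by (simp add: coprime_commute)
  have "[a' * modular_inverse (int p) b' * b * b' = a * b' * (b' * modular_inverse (int p) b')] (mod int p)"
    by (simp add: eq mult_ac)
  also have "[a * b' * (b' * modular_inverse (int p) b') = a * b' * 1] (mod int p)"
    by (intro cong_mult cong_refl cong_modular_inverse1 cop)
  finally have "[a' * modular_inverse (int p) b' * b = a] (mod int p)"
    using cop by (simp add: cong_mult_rcancel)
  thus ?thesis
    by (simp add: rat_residue_def q cong_def mod_mult_left_eq)
qed

definition adele_of_seq :: "(nat \<Rightarrow> rat) \<Rightarrow> adele" where
  "adele_of_seq x = abs_adele (\<lambda>p. rat_residue p (x p))"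

text \<open>The structure map of the \<open>\<rat>\<close>-algebra \<open>adele\<close>:\<close>

definition adele_of_rat :: "rat \<Rightarrow> adele" where
  "adele_of_rat r = adele_of_seq (\<lambda>_. r)"

lemma adele_rel_cofiniteI:
  assumes "b \<noteq> 0" "\<And>p. prime p \<Longrightarrow> \<not> int p dvd b \<Longrightarrow> [x p = y p] (mod int p)"
  shows   "adele_rel x y"
proof -
  have "{p. prime p \<and> \<not> [x p = y p] (mod int p)} \<subseteq> {p. p dvd nat \<bar>b\<bar>}"
    using assms(2) by (auto simp: int_dvd_int_iff)
  moreover have "finite {p. p dvd nat \<bar>b\<bar>}"
    using assms(1) by (intro finite_divisors_nat) auto
  ultimately show ?thesis
    unfolding adele_rel_def by (rule finite_subset)
qed

lemma rat_residue_cong_unique: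
  assumes "prime p" "b \<noteq> 0" "\<not> int p dvd b" "r = of_int a / of_int b" "[c * b = a] (mod int p)"
  shows   "[rat_residue p r = c] (mod int p)"
proof -
  have "coprime b (int p)"
    using assms(1,3) prime_imp_coprime[of "int p" b] by (simp add: coprime_commute)
  moreover have "[rat_residue p r * b = c * b] (mod int p)"
    using rat_residue_cong[OF assms(1-3)] assms(4,5) cong_sym cong_trans by blast
  ultimately show ?thesis
    by (simp add: cong_mult_rcancel)
qed

lemma adele_of_rat_of_int: "adele_of_rat (of_int n) = of_int n"
proof -
  have nat: "of_nat m = abs_adele (\<lambda>_. int m)" for m
  proof (induction m)
    case 0
    thus ?case
      by (simp add: zero_adele_def)
  next
    case (Suc m)
    have "of_nat (Suc m) = (1 :: adele) + of_nat m"
      by simp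
    also have "\<dots> = abs_adele (\<lambda>_. 1 + int m)"
      unfolding Suc.IH one_adele_def plus_adele.abs_eq ..
    finally show ?case
      by simp
  qed
  have "(of_int n :: adele) = abs_adele (\<lambda>_. n)"
    by (cases n rule: int_cases2)
       (auto simp: nat uminus_adele.abs_eq)
  moreover have "adele_rel (\<lambda>p. rat_residue p (of_int n)) (\<lambda>_. n)"
    by (rule adele_rel_cofiniteI[of 1])
       (auto intro!: rat_residue_cong_unique[where b = 1 and a = n])
  ultimately show ?thesis
    by (simp add: adele_of_rat_def adele_of_seq_def adele.abs_eq_iff)
qed

lemma adele_of_rat_1 [simp]: "adele_of_rat 1 = 1"
  using adele_of_rat_of_int[of 1] by simp

lemma adele_of_rat_add: "adele_of_rat (r + s) = adele_of_rat r + adele_of_rat s"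
  and adele_of_rat_mult: "adele_of_rat (r * s) = adele_of_rat r * adele_of_rat s"
proof -
  obtain a b c d where r: "r = of_int a / of_int b" "b \<noteq> 0" and s: "s = of_int c / of_int d" "d \<noteq> 0"
    by (metis Fract_of_int_quotient Rat_cases less_irrefl)
  have bd: "b * d \<noteq> 0"
    using r s by simp
  have sum: "r + s = of_int (a * d + c * b) / of_int (b * d)"
    and prod: "r * s = of_int (a * c) / of_int (b * d)"
    using r s by (simp_all add: field_simps)
  have *: "[rat_residue p (r + s) = rat_residue p r + rat_residue p s] (mod int p)"
          "[rat_residue p (r * s) = rat_residue p r * rat_residue p s] (mod int p)"
    if p: "prime p" "\<not> int p dvd b * d" for p
  proof -
    have "\<not> int p dvd b" "\<not> int p dvd d"
      using p by auto
    hence A: "[rat_residue p r * b = a] (mod int p)" and C: "[rat_residue p s * d = c] (mod int p)"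
      using rat_residue_cong[of p] p r s by auto
    have "[(rat_residue p r * b) * d + (rat_residue p s * d) * b = a * d + c * b] (mod int p)"
      by (intro cong_add cong_mult A C cong_refl)
    thus "[rat_residue p (r + s) = rat_residue p r + rat_residue p s] (mod int p)"
      by (intro rat_residue_cong_unique[OF p(1) bd p(2) sum]) (simp add: algebra_simps)
    have "[(rat_residue p r * b) * (rat_residue p s * d) = a * c] (mod int p)"
      by (intro cong_mult A C)
    thus "[rat_residue p (r * s) = rat_residue p r * rat_residue p s] (mod int p)"
      by (intro rat_residue_cong_unique[OF p(1) bd p(2) prod]) (simp add: algebra_simps)
  qed
  show "adele_of_rat (r + s) = adele_of_rat r + adele_of_rat s"
    unfolding adele_of_rat_def adele_of_seq_def plus_adele.abs_eq adele.abs_eq_iff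
    by (rule adele_rel_cofiniteI[OF bd *(1)])
  show "adele_of_rat (r * s) = adele_of_rat r * adele_of_rat s"
    unfolding adele_of_rat_def adele_of_seq_def times_adele.abs_eq adele.abs_eq_iff
    by (rule adele_rel_cofiniteI[OF bd *(2)])
qed


section \<open>Bernoulli numbers\<close>

definition bernoulli :: "nat \<Rightarrow> rat" where
  "bernoulli n = fact n * fps_nth (fps_X / (fps_exp 1 - 1)) n"

lemma bernoulli_egf: "Abs_fps (\<lambda>n. bernoulli n / fact n) * (fps_exp 1 - 1) = fps_X"
proof -
  have nz: "fps_nth (fps_exp 1 - 1 :: rat fps) 1 \<noteq> 0"
    by simp
  hence "fps_exp 1 - 1 \<noteq> (0 :: rat fps)"
    by (metis fps_zero_nth)
  moreover have "subdegree (fps_exp 1 - 1 :: rat fps) \<le> subdegree (fps_X :: rat fps)"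
    using subdegree_leI[OF nz] by simp
  ultimately have "fps_X / (fps_exp 1 - 1) * (fps_exp 1 - 1) = (fps_X :: rat fps)"
    by (intro dvd_div_mult_self) (simp add: fps_dvd_iff)
  moreover have "Abs_fps (\<lambda>n. bernoulli n / fact n) = fps_X / (fps_exp 1 - 1)"
    by (rule fps_ext) (simp add: bernoulli_def)
  ultimately show ?thesis
    by simp
qed


section \<open>Finite multiple T-values and related elements\<close>

text \<open>
  Summation indices \<open>p > n\<^sub>1 > \<dots> > n\<^sub>d > 0\<close> with \<open>n\<^sub>j \<equiv> d - j + 1 (mod 2)\<close>, as lists of length \<open>d\<close>.
  List positions start at \<open>0\<close>, so that \<open>n\<^sub>j\<close> is \<open>ns ! (j - 1)\<close>.
\<close>

definition T_indices :: "nat \<Rightarrow> nat \<Rightarrow> nat list set" where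
  "T_indices p d =
     {ns. length ns = d \<and> set ns \<subseteq> {0<..<p} \<and> sorted_wrt (>) ns \<and>
          (\<forall>i<d. [ns ! i = d - i] (mod 2))}"

lemma finite_T_indices: "finite (T_indices p d)"
  by (rule finite_subset[OF _ finite_lists_length_eq[of "{0<..<p}" d]]) (auto simp: T_indices_def)

definition T_adele :: "nat list \<Rightarrow> adele" where
  "T_adele s = adele_of_seq (\<lambda>p.
     \<Sum>ns \<in> T_indices p (length s). 2 ^ length s / (\<Prod>i<length s. of_nat (ns ! i) ^ (s ! i)))"

definition zeta_bar_adele :: "nat \<Rightarrow> adele" where
  "zeta_bar_adele k = adele_of_seq (\<lambda>p. \<Sum>n=1..p-1. (- 1) ^ n / of_nat n ^ k)"

text \<open>
  In the following two definitions, the components at the finitely many excluded primes are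
  set to \<open>0\<close>.
\<close>

definition fermat_quotient_2 :: adele where
  "fermat_quotient_2 = adele_of_seq (\<lambda>p. if p > 2 then (2 ^ (p - 1) - 1) / of_nat p else 0)"

definition bernoulli_adele :: "nat \<Rightarrow> adele" where
  "bernoulli_adele k = adele_of_seq (\<lambda>p. if p > k then bernoulli (p - k) / of_nat k else 0)"

end

theory Submission
  imports Defs "HOL-Computational_Algebra.Polynomial"
begin

text \<open>
  Fix an odd prime \<open>p\<close> and compute modulo \<open>p\<close>. The generating function of the sums
  \<open>\<Sum> (2 / n\<^sub>1) \<cdots> (2 / n\<^sub>d) t\<^sup>n\<close>, with \<open>n = n\<^sub>1\<close> and over all
  decreasing chains of alternating parity that end in an odd number, is
  \<open>((1 + t) / (1 - t))\<^sup>x\<close>, where \<open>x\<close> marks the length \<open>d\<close>. Hence the finite sums with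
  \<open>n\<^sub>1 < p\<close> have as generating function in \<open>x\<close> the coefficient of \<open>t\<^sup>p\<^sup>-\<^sup>1\<close> in
  \<open>(1 + t)\<^sup>x (1 - t)\<^sup>-\<^sup>x\<^sup>-\<^sup>1\<close>, a polynomial \<open>P(x)\<close> of degree at most \<open>p - 1\<close>. At an integer \<open>x = a\<close>
  with \<open>0 < a < p\<close>, the congruence of \<open>(1 - t)\<^sup>p\<close> and \<open>1 - t\<^sup>p\<close> turns it into the coefficient
  of \<open>t\<^sup>p\<^sup>-\<^sup>1\<close> in \<open>(1 + t)\<^sup>a (1 - t)\<^sup>p\<^sup>-\<^sup>1\<^sup>-\<^sup>a\<close>, which is the leading coefficient \<open>(- 1)\<^sup>a\<close>
  (\<open>chain_sum_generating_function_cong\<close>). As the sum of \<open>a\<^sup>m\<close> over the nonzero residues \<open>a\<close> is \<open>-1\<close> or \<open>0\<close>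
  according to whether \<open>p - 1\<close> divides \<open>m\<close>, the coefficient of \<open>x\<^sup>k\<close> in \<open>P(x)\<close>, for \<open>0 < k < p - 1\<close>, is
  \<open>- (\<Sum>a=1..p-1. (- 1)\<^sup>a / a\<^sup>k)\<close> (\<open>chain_sum_cong_alternating_power_sum\<close>). This is the first identity.

  Instead of manipulating power series with denominators modulo \<open>p\<close>, the lemmas on this identity
  compare both sides through the linear recurrences that they satisfy; for the polynomials these
  come from a differential equation.
  The generating function is split into \<open>parity_part\<close>s, which amounts to dividing by
  \<open>1 - t\<^sup>2\<close>, so that the polynomials become \<open>(1 + t)\<^sup>a\<^sup>-\<^sup>1 (1 - t)\<^sup>p\<^sup>-\<^sup>1\<^sup>-\<^sup>a\<close>, of degree \<open>p - 2\<close>.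

  For the alternating sum replace \<open>1 / n\<^sup>k\<close> by \<open>n\<^sup>e\<close> with \<open>e = p - 1 - k\<close>. The substitution
  \<open>n \<mapsto> p - n\<close> shows that it vanishes for even \<open>k\<close>. For \<open>k = 1\<close> it is found in the binomial
  expansion of \<open>2\<^sup>p\<close>, divided by \<open>p\<close> (\<open>fermat_quotient_2_cong\<close>). For odd \<open>k \<ge> 3\<close>, the exponential
  generating function of the alternating power sums over \<open>n < p\<close> is \<open>(1 + e\<^sup>p\<^sup>t) / (1 + e\<^sup>t)\<close>, whose
  coefficients are congruent to those of \<open>2 / (1 + e\<^sup>t)\<close> (\<open>reduces_to_euler_coeff\<close>). The latter
  are expressed by Bernoulli numbers by means of
  \<open>1 / (e\<^sup>t + 1) = 1 / (e\<^sup>t - 1) - 2 / (e\<^sup>2\<^sup>t - 1)\<close>.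
\<close>


section \<open>Rational numbers modulo a prime\<close>

text \<open>
  The rational number \<open>r\<close> has a denominator prime to \<open>p\<close> and \<open>z\<close> is a representative of its
  residue class. As a relation, unlike \<open>rat_residue\<close>, it carries the integrality of \<open>r\<close> along,
  so that residues may be added and multiplied without separate side conditions.
\<close>

definition reduces_to :: "nat \<Rightarrow> rat \<Rightarrow> int \<Rightarrow> bool" where
  "reduces_to p r z \<longleftrightarrow>
     (\<exists>a b. \<not> int p dvd b \<and> r = of_int a / of_int b \<and> [a = z * b] (mod int p))"

lemma rat_residue_reduces_to:
  assumes "prime p" "reduces_to p r z"
  shows   "[rat_residue p r = z] (mod int p)"
proof -
  obtain a b where ab: "\<not> int p dvd b" "r = of_int a / of_int b" "[a = z * b] (mod int p)"
    using assms(2) by (auto simp: reduces_to_def)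
  have "b \<noteq> 0"
    using ab(1) by auto
  thus ?thesis
    using ab by (intro rat_residue_cong_unique[OF assms(1)]) (auto simp: cong_sym_eq)
qed

lemma reduces_to_unique:
  assumes "prime p" "reduces_to p r z" "reduces_to p r w"
  shows   "[z = w] (mod int p)"
  using assms rat_residue_reduces_to by (meson cong_sym cong_trans)

lemma reduces_to_of_int:
  assumes "prime p" "[n = z] (mod int p)"
  shows   "reduces_to p (of_int n) z"
  unfolding reduces_to_def using assms
  by (intro exI[of _ n] exI[of _ 1]) auto

lemma reduces_to_cong:
  assumes "reduces_to p r z" "[z = z'] (mod int p)"
  shows   "reduces_to p r z'"
proof -
  obtain a b where ab: "\<not> int p dvd b" "r = of_int a / of_int b" "[a = z * b] (mod int p)"
    using assms(1) by (auto simp: reduces_to_def)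
  moreover have "[a = z' * b] (mod int p)"
    using ab(3) cong_mult[OF assms(2) cong_refl] by (rule cong_trans)
  ultimately show ?thesis
    unfolding reduces_to_def by blast
qed

lemma reduces_to_add:
  assumes "prime p" "reduces_to p r z" "reduces_to p s w"
  shows   "reduces_to p (r + s) (z + w)"
proof -
  obtain a b where ab: "\<not> int p dvd b" "r = of_int a / of_int b" "[a = z * b] (mod int p)"
    using assms(2) by (auto simp: reduces_to_def)
  obtain c d where cd: "\<not> int p dvd d" "s = of_int c / of_int d" "[c = w * d] (mod int p)"
    using assms(3) by (auto simp: reduces_to_def)
  have "\<not> int p dvd b * d"
    using ab cd assms(1) by (simp add: prime_dvd_mult_iff)
  moreover have "b \<noteq> 0" "d \<noteq> 0"
    using ab cd by auto
  hence "r + s = of_int (a * d + c * b) / of_int (b * d)"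
    by (simp add: ab cd field_simps)
  moreover have "[a * d + c * b = (z * b) * d + (w * d) * b] (mod int p)"
    by (intro cong_add cong_mult ab cd cong_refl)
  hence "[a * d + c * b = (z + w) * (b * d)] (mod int p)"
    by (simp add: algebra_simps)
  ultimately show ?thesis
    unfolding reduces_to_def by blast
qed

lemma reduces_to_mult:
  assumes "prime p" "reduces_to p r z" "reduces_to p s w"
  shows   "reduces_to p (r * s) (z * w)"
proof -
  obtain a b where ab: "\<not> int p dvd b" "r = of_int a / of_int b" "[a = z * b] (mod int p)"
    using assms(2) by (auto simp: reduces_to_def)
  obtain c d where cd: "\<not> int p dvd d" "s = of_int c / of_int d" "[c = w * d] (mod int p)"
    using assms(3) by (auto simp: reduces_to_def)
  have "\<not> int p dvd b * d"
    using ab cd assms(1) by (simp add: prime_dvd_mult_iff)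
  moreover have "r * s = of_int (a * c) / of_int (b * d)"
    by (simp add: ab cd)
  moreover have "[a * c = (z * b) * (w * d)] (mod int p)"
    by (intro cong_mult ab cd)
  hence "[a * c = (z * w) * (b * d)] (mod int p)"
    by (simp add: mult_ac)
  ultimately show ?thesis
    unfolding reduces_to_def by blast
qed

lemma reduces_to_minus:
  assumes "prime p" "reduces_to p r z"
  shows   "reduces_to p (- r) (- z)"
  using reduces_to_mult[OF assms(1) reduces_to_of_int[OF assms(1) cong_refl, of "-1"] assms(2)]
  by simp

lemma reduces_to_sum:
  assumes "prime p" "\<And>i. i \<in> I \<Longrightarrow> reduces_to p (r i) (z i)"
  shows   "reduces_to p (sum r I) (sum z I)"
  using assms(2) reduces_to_of_int[OF assms(1) cong_refl, of 0]
  by (induction I rule: infinite_finite_induct) (auto intro: reduces_to_add[OF assms(1)])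

lemma reduces_to_prod_list:
  assumes "prime p" "\<And>n. n \<in> set ns \<Longrightarrow> reduces_to p (f n) (g n)"
  shows   "reduces_to p (prod_list (map f ns)) (prod_list (map g ns))"
  using assms(2) reduces_to_of_int[OF assms(1) cong_refl, of 1]
  by (induction ns) (auto intro: reduces_to_mult[OF assms(1)])

lemma reduces_to_divide:
  assumes "prime p" "reduces_to p r z" "\<not> int p dvd n" "[n * w = z] (mod int p)"
  shows   "reduces_to p (r / of_int n) w"
proof -
  obtain a b where ab: "\<not> int p dvd b" "r = of_int a / of_int b" "[a = z * b] (mod int p)"
    using assms(2) by (auto simp: reduces_to_def)
  have "\<not> int p dvd b * n"
    using ab assms(1,3) by (simp add: prime_dvd_mult_iff)
  moreover have "r / of_int n = of_int a / of_int (b * n)"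
    by (simp add: ab)
  moreover have "[z * b = n * w * b] (mod int p)"
    by (intro cong_mult cong_refl cong_sym[OF assms(4)])
  hence "[a = w * (b * n)] (mod int p)"
    using ab(3) cong_trans by (fastforce simp: mult_ac)
  ultimately show ?thesis
    unfolding reduces_to_def by blast
qed

lemma adele_of_seq_eq_abs_adele:
  assumes "\<And>p. prime p \<Longrightarrow> p > N \<Longrightarrow> reduces_to p (x p) (z p)"
  shows   "adele_of_seq x = abs_adele z"
proof -
  have "{p. prime p \<and> \<not> [rat_residue p (x p) = z p] (mod int p)} \<subseteq> {..N}"
    using assms rat_residue_reduces_to by (auto simp: not_less[symmetric])
  thus ?thesis
    unfolding adele_of_seq_def adele.abs_eq_iff adele_rel_def by (rule finite_subset) auto
qed

lemma abs_adele_eqI: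
  assumes "\<And>p. prime p \<Longrightarrow> p > N \<Longrightarrow> [x p = y p] (mod int p)"
  shows   "abs_adele x = abs_adele y"
proof -
  have "{p. prime p \<and> \<not> [x p = y p] (mod int p)} \<subseteq> {..N}"
    using assms by (auto simp: not_less[symmetric])
  thus ?thesis
    unfolding adele.abs_eq_iff adele_rel_def by (rule finite_subset) auto
qed

lemma fermat_int:
  assumes "prime p" "\<not> int p dvd n"
  shows   "[n ^ (p - 1) = 1] (mod int p)"
proof -
  have "[(nat (n mod int p)) ^ (p - 1) = 1] (mod p)"
  proof (rule fermat_theorem[OF assms(1)])
    show "\<not> p dvd nat (n mod int p)"
      using assms prime_gt_0_nat[OF assms(1)]
      by (metis dvd_mod_iff int_dvd_int_iff dvd_refl int_nat_eq mod_0_imp_dvd nat_0_iff of_nat_0_less_iff pos_mod_sign)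
  qed
  hence "[int (nat (n mod int p)) ^ (p - 1) = 1] (mod int p)"
    by (metis cong_int_iff of_nat_1 of_nat_power)
  hence "[(n mod int p) ^ (p - 1) = 1] (mod int p)"
    using prime_gt_0_nat[OF assms(1)] by simp
  thus ?thesis
    by (simp add: cong_def power_mod)
qed

lemma not_dvd_of_less: "0 < n \<Longrightarrow> n < p \<Longrightarrow> \<not> int p dvd int n"
  by (intro zdvd_not_zless) auto

lemma not_dvd_power:
  assumes "prime p" "\<not> int p dvd x"
  shows   "\<not> int p dvd x ^ k"
  using assms prime_dvd_power[of "int p" x k] by auto

lemma not_dvd_2:
  assumes "prime p" "odd p"
  shows   "\<not> int p dvd 2"
proof -
  have "p > 2"
    using assms prime_ge_2_nat[of p] by (cases "p = 2") auto
  thus ?thesis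
    using not_dvd_of_less[of 2 p] by simp
qed

lemma power_inverse_cong:
  assumes "prime p" "0 < n" "n < p" "k < p"
  shows   "[int n ^ k * int n ^ (p - 1 - k) = 1] (mod int p)"
  using fermat_int[OF assms(1) not_dvd_of_less[OF assms(2,3)]] assms(4)
  by (simp flip: power_add)


section \<open>Sums over chains of alternating parity\<close>

definition chain_sum :: "(nat \<Rightarrow> 'a :: comm_ring_1) \<Rightarrow> nat \<Rightarrow> nat \<Rightarrow> 'a" where
  "chain_sum f N d = (\<Sum>ns\<in>T_indices N d. prod_list (map f ns))"

lemma T_indices_0 [simp]: "T_indices N 0 = {[]}"
  by (auto simp: T_indices_def)

text \<open>
  The parity condition of \<open>T_indices\<close> counts from the end of the list, hence the tail of an
  admissible list is admissible, and only the parity of the new largest entry is constrained.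
\<close>

lemma Cons_in_T_indices_iff:
  "n # ns \<in> T_indices N (Suc d) \<longleftrightarrow>
     0 < n \<and> n < N \<and> odd (n + d) \<and> ns \<in> T_indices n d"
proof -
  have par: "(\<forall>i<Suc d. [(n # ns) ! i = Suc d - i] (mod 2)) \<longleftrightarrow>
              odd (n + d) \<and> (\<forall>i<d. [ns ! i = d - i] (mod 2))"
    unfolding All_less_Suc2 by (auto simp: cong_def mod2_eq_if)
  show ?thesis
    unfolding T_indices_def mem_Collect_eq par by fastforce
qed

lemma T_indices_Suc_Suc:
  "T_indices (Suc N) (Suc d) =
     T_indices N (Suc d) \<union> (if N > 0 \<and> odd (N + d) then (#) N ` T_indices N d else {})"
proof (rule Set.set_eqI)
  fix ns
  show "ns \<in> T_indices (Suc N) (Suc d) \<longleftrightarrow>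
          ns \<in> T_indices N (Suc d) \<union> (if N > 0 \<and> odd (N + d) then (#) N ` T_indices N d else {})"
  proof (cases ns)
    case Nil
    thus ?thesis
      by (auto simp: T_indices_def)
  next
    case (Cons n ms)
    thus ?thesis
      by (auto simp: Cons_in_T_indices_iff less_Suc_eq)
  qed
qed

lemma chain_sum_0 [simp]: "chain_sum f N 0 = 1"
  by (simp add: chain_sum_def)

lemma chain_sum_Suc_Suc:
  "chain_sum f (Suc N) (Suc d) = chain_sum f N (Suc d) +
     (if N > 0 \<and> odd (N + d) then f N * chain_sum f N d else 0)"
proof -
  have "T_indices N (Suc d) \<inter> (#) N ` T_indices N d = {}"
    by (auto simp: Cons_in_T_indices_iff)
  moreover have "(\<Sum>ns\<in>(#) N ` T_indices N d. prod_list (map f ns)) = f N * chain_sum f N d"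
    by (subst sum.reindex) (auto simp: chain_sum_def sum_distrib_left)
  ultimately show ?thesis
    unfolding chain_sum_def[of f "Suc N"] T_indices_Suc_Suc
    by (auto simp: sum.union_disjoint finite_T_indices chain_sum_def)
qed

lemma chain_sum_eq_0: "0 < d \<Longrightarrow> N \<le> d \<Longrightarrow> chain_sum f N d = 0"
proof (induction N arbitrary: d)
  case 0
  have "T_indices 0 d = {}"
    using 0 by (auto simp: T_indices_def)
  thus ?case
    by (simp add: chain_sum_def)
next
  case (Suc N)
  thus ?case
    by (cases d) (auto simp: chain_sum_Suc_Suc)
qed

lemma chain_sum_Suc_same:
  "odd (N + d) \<Longrightarrow> chain_sum f (Suc N) d = chain_sum f N d"
  by (cases d) (auto simp: chain_sum_Suc_Suc)

text \<open>
  Since \<open>chain_sum f (N + 1) d\<close> and \<open>chain_sum f N d\<close> agree if \<open>N + d\<close> is odd, the generating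
  function of the sums below \<open>N + 1\<close> is the sum of its parts of either parity at \<open>N + 1\<close> and
  at \<open>N\<close>. These parts satisfy a recurrence with three terms. For \<open>f n = 2 / n\<close>
  the value at \<open>N + 1\<close> is the coefficient of \<open>t\<^sup>N\<close> in \<open>(1 + t)\<^sup>x\<^sup>-\<^sup>1 (1 - t)\<^sup>-\<^sup>x\<^sup>-\<^sup>1\<close>.
\<close>

definition parity_part :: "(nat \<Rightarrow> 'a :: comm_ring_1) \<Rightarrow> 'a \<Rightarrow> nat \<Rightarrow> 'a" where
  "parity_part f x N = (\<Sum>d<N. if odd (N + d) then chain_sum f N d * x ^ d else 0)"

lemma parity_part_0 [simp]: "parity_part f x 0 = 0"
  and parity_part_1 [simp]: "parity_part f x (Suc 0) = 1"
  by (simp_all add: parity_part_def)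

text \<open>
  Passing from \<open>N\<close> to \<open>N + 2\<close> admits the two new largest entries \<open>N\<close> and \<open>N + 1\<close>, of which
  only \<open>N + 1\<close> has the parity that the surviving lengths require.
\<close>

lemma parity_part_Suc_Suc:
  "parity_part f x (Suc (Suc N)) =
     parity_part f x N + x * f (Suc N) * parity_part f x (Suc N)"
proof -
  have eq: "(if odd (N + Suc d) then chain_sum f (Suc (Suc N)) (Suc d) * x ^ Suc d else 0) =
        (if odd (N + Suc d) then chain_sum f N (Suc d) * x ^ Suc d else 0) +
        x * f (Suc N) * (if odd (Suc N + d) then chain_sum f (Suc N) d * x ^ d else 0)" for d
    using chain_sum_Suc_Suc[of f "Suc N" d] chain_sum_Suc_same[of N "Suc d" f]
    by (auto simp: algebra_simps)
  have "parity_part f x (Suc (Suc N)) =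
          (if odd N then 1 else 0) +
          (\<Sum>d<Suc N. if odd (N + Suc d) then chain_sum f (Suc (Suc N)) (Suc d) * x ^ Suc d else 0)"
    unfolding parity_part_def by (subst sum.lessThan_Suc_shift) simp
  also have "\<dots> = ((if odd N then 1 else 0) +
          (\<Sum>d<Suc N. if odd (N + Suc d) then chain_sum f N (Suc d) * x ^ Suc d else 0)) +
          x * f (Suc N) * parity_part f x (Suc N)"
    unfolding eq by (simp only: sum.distrib sum_distrib_left parity_part_def add.assoc)
  also have "(if odd N then 1 else 0) +
          (\<Sum>d<Suc N. if odd (N + Suc d) then chain_sum f N (Suc d) * x ^ Suc d else 0) =
          (\<Sum>d<Suc (Suc N). if odd (N + d) then chain_sum f N d * x ^ d else 0)"
    by (subst (2) sum.lessThan_Suc_shift) simp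
  also have "\<dots> = parity_part f x N"
    by (simp add: parity_part_def chain_sum_eq_0)
  finally show ?thesis .
qed

lemma chain_sum_generating_function:
  "(\<Sum>d<Suc N. chain_sum f (Suc N) d * x ^ d) = parity_part f x (Suc N) + parity_part f x N"
proof -
  have "(\<Sum>d<Suc N. chain_sum f (Suc N) d * x ^ d) =
          (\<Sum>d<Suc N. (if odd (Suc N + d) then chain_sum f (Suc N) d * x ^ d else 0) +
                     (if odd (N + d) then chain_sum f N d * x ^ d else 0))"
    by (intro sum.cong refl) (auto simp: chain_sum_Suc_same)
  also have "\<dots> = parity_part f x (Suc N) +
               (\<Sum>d<Suc N. if odd (N + d) then chain_sum f N d * x ^ d else 0)"
    by (simp only: sum.distrib parity_part_def)
  finally show ?thesis
    by (simp add: parity_part_def)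
qed


section \<open>Coefficients of products of two linear powers\<close>

text \<open>
  The logarithmic derivative of \<open>Q\<close> is \<open>m / (1 + t) - n / (1 - t)\<close>.
\<close>

lemma pderiv_two_linear_powers:
  fixes m n :: nat
  defines "Q \<equiv> [:1, 1:] ^ m * [:1, -1:] ^ n :: int poly"
  shows "pderiv Q * [:1, 0, -1:] = Q * [:int m - int n, - int m - int n:]"
proof -
  have A: "pderiv ([:1, 1:] ^ m) * [:1, 1:] = smult (int m) ([:1, 1:] ^ m)"
    by (cases m) (simp_all add: pderiv_power_Suc pderiv_pCons del: power_Suc, simp add: mult_ac smult_add_right)
  have B: "pderiv ([:1, -1:] ^ n) * [:1, -1:] = smult (- int n) ([:1, -1:] ^ n)"
    by (cases n) (simp_all add: pderiv_power_Suc pderiv_pCons del: power_Suc, simp add: mult_ac smult_add_right flip: smult_minus_left)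
  have "[:1, 0, -1:] = [:1, 1:] * [:1, -1 :: int:]"
    by simp
  hence "pderiv Q * [:1, 0, -1:] =
          (pderiv ([:1, 1:] ^ m) * [:1, 1:]) * [:1, -1:] ^ n * [:1, -1:] +
          (pderiv ([:1, -1:] ^ n) * [:1, -1:]) * [:1, 1:] ^ m * [:1, 1:]"
    unfolding Q_def pderiv_mult by (simp only: algebra_simps)
  also have "\<dots> = Q * (smult (int m) [:1, -1:] + smult (- int n) [:1, 1:])"
    unfolding A B Q_def by (simp only: algebra_simps mult_smult_left mult_smult_right)
  also have "smult (int m) [:1, -1:] + smult (- int n) [:1, 1:] = 
               [:int m - int n, - int m - int n:]"
    by simp
  finally show ?thesis .
qed

text \<open>
  This compares coefficients of \<open>t\<^sup>j\<close> in the differential equation for \<open>Q\<close>; \<open>pCons 0 Q\<close>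
  supplies the coefficient of \<open>t\<^sup>j\<^sup>-\<^sup>1\<close> in \<open>Q\<close>, or \<open>0\<close> if \<open>j = 0\<close>.
\<close>

lemma coeff_two_linear_powers_rec:
  fixes m n :: nat
  defines "Q \<equiv> [:1, 1:] ^ m * [:1, -1:] ^ n :: int poly"
  shows "int (Suc j) * coeff Q (Suc j) =
     (int m - int n) * coeff Q j + (int j - 1 - int m - int n) * coeff (pCons 0 Q) j"
proof -
  have "coeff (pderiv Q * [:1, 0, -1:]) j = coeff (Q * [:int m - int n, - int m - int n:]) j"
    unfolding Q_def pderiv_two_linear_powers ..
  moreover have "coeff (pderiv Q * [:1, 0, -1:]) j =
                   int (Suc j) * coeff Q (Suc j) - (int j - 1) * coeff (pCons 0 Q) j"
    by (cases j; cases "j - 1") (simp_all add: mult.commute[of _ "pCons _ _"] coeff_pderiv)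
  moreover have "coeff (Q * [:int m - int n, - int m - int n:]) j =
      (int m - int n) * coeff Q j + (- int m - int n) * coeff (pCons 0 Q) j"
    by (cases j) (simp_all add: mult.commute[of _ "pCons _ _"])
  ultimately show ?thesis
    by (simp add: algebra_simps)
qed

lemma coeff_two_linear_powers_degree:
  "coeff ([:1, 1:] ^ m * [:1, -1:] ^ n :: int poly) (m + n) = (-1) ^ n"
  and coeff_two_linear_powers_above:
  "m + n < j \<Longrightarrow> coeff ([:1, 1:] ^ m * [:1, -1:] ^ n :: int poly) j = 0"
proof -
  have deg: "degree ([:1, 1:] ^ m * [:1, -1:] ^ n :: int poly) = m + n"
    by (simp add: degree_mult_eq degree_power_eq)
  show "m + n < j \<Longrightarrow> coeff ([:1, 1:] ^ m * [:1, -1:] ^ n :: int poly) j = 0"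
    by (rule coeff_eq_0) (simp add: deg)
  have "lead_coeff ([:1, 1:] ^ m * [:1, -1:] ^ n :: int poly) = (-1) ^ n"
    by (simp add: lead_coeff_mult lead_coeff_power)
  thus "coeff ([:1, 1:] ^ m * [:1, -1:] ^ n :: int poly) (m + n) = (-1) ^ n"
    unfolding deg .
qed


section \<open>The generating function modulo a prime\<close>

text \<open>
  Modulo \<open>p\<close> the exponent \<open>- a - 1\<close> in the generating function may be replaced by \<open>p - 1 - a\<close>,
  as long as only coefficients below \<open>t\<^sup>p\<close> matter, because \<open>(1 - t)\<^sup>p\<close> is \<open>1 - t\<^sup>p\<close>. Here this is
  reflected by both sides satisfying the same recurrence modulo \<open>p\<close>, in which the factor of the
  highest term is positive and less than \<open>p\<close>, hence invertible. The polynomial \<open>pCons 0 Q\<close> accounts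
  for \<open>N\<close> belonging to \<open>t\<^sup>N\<^sup>-\<^sup>1\<close>, and for the value \<open>0\<close> at \<open>N = 0\<close>.
\<close>

lemma parity_part_cong_coeff:
  fixes p a :: nat and f :: "nat \<Rightarrow> int"
  assumes "prime p" "0 < a" "a < p"
  assumes f: "\<And>n. 0 < n \<Longrightarrow> n < p \<Longrightarrow> [int n * f n = 2] (mod int p)"
  defines "Q \<equiv> [:1, 1:] ^ (a - 1) * [:1, -1:] ^ (p - 1 - a) :: int poly"
  shows "N \<le> p \<Longrightarrow> [parity_part f (int a) N = coeff (pCons 0 Q) N] (mod int p)"
proof (induction N rule: less_induct)
  case (less N)
  consider "N = 0" | "N = 1" | n where "N = Suc (Suc n)"
    by (metis One_nat_def not0_implies_Suc)
  thus ?case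
  proof cases
    case 2
    have "poly Q 0 = 1"
      by (simp add: Q_def)
    thus ?thesis
      using 2 by (simp add: poly_0_coeff_0)
  next
    case (3 n)
    let ?q = "coeff (pCons 0 Q)"
    let ?M = "int (Suc n)"
    have n: "Suc n < p"
      using less.prems 3 by simp
    have V: "[parity_part f (int a) n = ?q n] (mod int p)"
            "[parity_part f (int a) (Suc n) = ?q (Suc n)] (mod int p)"
      using less.IH[of n] less.IH[of "Suc n"] 3 n by auto
    have ap: "int (a - 1) - int (p - 1 - a) = 2 * int a - int p"
             "int n - 1 - int (a - 1) - int (p - 1 - a) = ?M - int p"
      using assms(2,3) by auto
    have rec: "?M * ?q (Suc (Suc n)) = (2 * int a - int p) * ?q (Suc n) + (?M - int p) * ?q n"
      using coeff_two_linear_powers_rec[of n "a - 1" "p - 1 - a"]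
      unfolding ap Q_def[symmetric] by simp
    have "[?M * parity_part f (int a) N =
             ?M * parity_part f (int a) n + int a * (?M * f (Suc n)) * parity_part f (int a) (Suc n)] (mod int p)"
      unfolding 3 parity_part_Suc_Suc by (simp add: algebra_simps)
    also have "[?M * parity_part f (int a) n + int a * (?M * f (Suc n)) * parity_part f (int a) (Suc n)
                = ?M * ?q n + int a * 2 * ?q (Suc n)] (mod int p)"
      using n by (intro cong_add cong_mult cong_refl V f) auto
    also have "[?M * ?q n + int a * 2 * ?q (Suc n) = ?M * ?q N] (mod int p)"
    proof -
      have "?M * ?q n + int a * 2 * ?q (Suc n) - ?M * ?q N = int p * (?q (Suc n) + ?q n)"
        unfolding 3 rec by (simp add: algebra_simps)
      thus ?thesis
        by (simp add: cong_iff_dvd_diff)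
    qed
    finally have "[?M * parity_part f (int a) N = ?M * ?q N] (mod int p)" .
    moreover have "\<not> int p dvd ?M"
      using n by (simp add: zdvd_not_zless)
    hence "coprime ?M (int p)"
      using assms(1) prime_imp_coprime[of "int p" ?M] by (simp add: coprime_commute)
    ultimately show ?thesis
      by (simp add: cong_mult_lcancel)
  qed simp
qed

text \<open>
  The polynomial \<open>Q\<close> has degree \<open>p - 2\<close>, so that of the two coefficients that make up the generating
  function, those of \<open>t\<^sup>p\<^sup>-\<^sup>1\<close> and \<open>t\<^sup>p\<^sup>-\<^sup>2\<close>, the first vanishes and the second is the leading one.
\<close>

lemma chain_sum_generating_function_cong:
  fixes p a :: nat and f :: "nat \<Rightarrow> int"
  assumes "prime p" "odd p" "0 < a" "a < p"
  assumes f: "\<And>n. 0 < n \<Longrightarrow> n < p \<Longrightarrow> [int n * f n = 2] (mod int p)"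
  shows "[(\<Sum>d<p. chain_sum f p d * int a ^ d) = (-1) ^ a] (mod int p)"
proof -
  define Q where "Q = ([:1, 1:] ^ (a - 1) * [:1, -1:] ^ (p - 1 - a) :: int poly)"
  have p: "p = Suc (Suc (a - 1 + (p - 1 - a)))"
    using assms(3,4) by simp
  note cong = parity_part_cong_coeff[OF assms(1,3,4) f, folded Q_def]
  have "[parity_part f (int a) p + parity_part f (int a) (p - 1) =
          coeff (pCons 0 Q) p + coeff (pCons 0 Q) (p - 1)] (mod int p)"
    by (intro cong_add cong) auto
  also have "coeff (pCons 0 Q) p = 0"
    by (subst p) (simp add: Q_def coeff_two_linear_powers_above)
  also have "coeff (pCons 0 Q) (p - 1) = (-1) ^ (p - 1 - a)"
    by (subst p) (simp add: Q_def coeff_two_linear_powers_degree)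
  also have "(-1) ^ (p - 1 - a) = ((-1) ^ a :: int)"
    using assms(2,4) by (auto simp: minus_one_power_iff)
  also have "parity_part f (int a) p + parity_part f (int a) (p - 1) =
              (\<Sum>d<p. chain_sum f p d * int a ^ d)"
    using chain_sum_generating_function[of f "p - 1" "int a"] assms(4) by simp
  finally show ?thesis
    by simp
qed


section \<open>Power sums modulo a prime\<close>

text \<open>
  The inner sum over \<open>j\<close> is \<open>(n + 1)\<^sup>m\<^sup>+\<^sup>1 - n\<^sup>m\<^sup>+\<^sup>1\<close>, which telescopes.
\<close>

lemma power_sum_rec:
  "(\<Sum>j\<le>m. int (Suc m choose j) * (\<Sum>n<N. int n ^ j)) = int N ^ Suc m"
proof -
  have "(\<Sum>j\<le>m. int (Suc m choose j) * (\<Sum>n<N. int n ^ j)) =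
          (\<Sum>n<N. \<Sum>j\<le>m. int (Suc m choose j) * int n ^ j)"
    by (simp only: sum_distrib_left sum.swap[of _ "{..m}"])
  also have "\<dots> = (\<Sum>n<N. int (Suc n) ^ Suc m - int n ^ Suc m)"
  proof (intro sum.cong refl)
    fix n
    have "int (Suc n) ^ Suc m = (int n + 1) ^ Suc m"
      by (simp add: add.commute)
    also have "\<dots> = (\<Sum>j\<le>Suc m. int (Suc m choose j) * int n ^ j)"
      unfolding binomial_ring by simp
    finally show "(\<Sum>j\<le>m. int (Suc m choose j) * int n ^ j) = int (Suc n) ^ Suc m - int n ^ Suc m"
      by simp
  qed
  also have "\<dots> = int N ^ Suc m"
    by (subst sum_lessThan_telescope) simp
  finally show ?thesis .
qed

text \<open>
  In the recurrence all power sums with smaller exponent vanish by induction, and the factor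
  \<open>m + 1\<close> of the last one is less than \<open>p\<close>.
\<close>

lemma power_sum_cong_0:
  assumes "prime p" "m < p - 1"
  shows   "[(\<Sum>n<p. int n ^ m) = 0] (mod int p)"
  using assms(2)
proof (induction m rule: less_induct)
  case (less m)
  have "[(\<Sum>j<m. int (Suc m choose j) * (\<Sum>n<p. int n ^ j)) = (\<Sum>j<m. int (Suc m choose j) * 0)] (mod int p)"
    using less by (intro cong_sum cong_mult cong_refl) auto
  hence "[int (Suc m) * (\<Sum>n<p. int n ^ m) + (\<Sum>j<m. int (Suc m choose j) * (\<Sum>n<p. int n ^ j)) =
           int (Suc m) * (\<Sum>n<p. int n ^ m) + 0] (mod int p)"
    by (intro cong_add cong_refl) simp
  moreover have "int (Suc m) * (\<Sum>n<p. int n ^ m) + (\<Sum>j<m. int (Suc m choose j) * (\<Sum>n<p. int n ^ j)) = int p ^ Suc m"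
    unfolding power_sum_rec[symmetric] by (simp add: lessThan_Suc_atMost[symmetric])
  ultimately have "int p dvd int (Suc m) * (\<Sum>n<p. int n ^ m)"
    by (auto simp: cong_def dvd_eq_mod_eq_0)
  moreover have "\<not> int p dvd int (Suc m)"
    using less.prems by (intro zdvd_not_zless) auto
  ultimately show ?case
    using assms(1) by (simp add: prime_dvd_mult_iff cong_0_iff)
qed

text \<open>
  Fermat's theorem reduces exponents above \<open>p - 1\<close> by \<open>p - 1\<close>. The range of \<open>m\<close> covers all
  exponents that occur when a polynomial of degree at most \<open>p - 1\<close> is multiplied by a power between
  the first and the \<open>(p - 2)\<close>-th.
\<close>

lemma power_sum_cong:
  assumes "prime p" "0 < m" "m < 2 * (p - 1)"
  shows   "[(\<Sum>a=1..<p. int a ^ m) = (if m = p - 1 then -1 else 0)] (mod int p)"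
proof -
  consider "m < p - 1" | "m = p - 1" | "p - 1 < m"
    by linarith
  thus ?thesis
  proof cases
    case 1
    have "(\<Sum>a=1..<p. int a ^ m) = (\<Sum>a<p. int a ^ m)"
      using assms(2) by (intro sum.mono_neutral_left) (auto simp: not_less_eq_eq)
    thus ?thesis
      using power_sum_cong_0[OF assms(1) 1] 1 by simp
  next
    case 2
    have "[(\<Sum>a=1..<p. int a ^ m) = (\<Sum>a=1..<p. 1)] (mod int p)"
      unfolding 2 using zdvd_not_zless
      by (intro cong_sum fermat_int[OF assms(1)]) auto
    also have "(\<Sum>a=1..<p. 1) = int p - 1"
      using prime_gt_0_nat[OF assms(1)] by simp
    also have "[int p - 1 = -1] (mod int p)"
      by (simp add: cong_iff_dvd_diff)
    finally show ?thesis
      using 2 by simp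
  next
    case 3
    have "[(\<Sum>a=1..<p. int a ^ m) = (\<Sum>a=1..<p. int a ^ (m - (p - 1)))] (mod int p)"
    proof (intro cong_sum)
      fix a assume a: "a \<in> {1..<p}"
      have "[int a ^ (p - 1) * int a ^ (m - (p - 1)) = 1 * int a ^ (m - (p - 1))] (mod int p)"
        using a zdvd_not_zless
        by (intro cong_mult cong_refl fermat_int[OF assms(1)]) auto
      thus "[int a ^ m = int a ^ (m - (p - 1))] (mod int p)"
        using 3 by (simp flip: power_add)
    qed
    also have "(\<Sum>a=1..<p. int a ^ (m - (p - 1))) = (\<Sum>a<p. int a ^ (m - (p - 1)))"
      using 3 by (intro sum.mono_neutral_left) (auto simp: not_less_eq_eq)
    also have "[\<dots> = 0] (mod int p)"
      using assms(3) 3 by (intro power_sum_cong_0[OF assms(1)]) auto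
    finally show ?thesis
      using 3 by simp
  qed
qed

text \<open>
  The term \<open>n = 0\<close> matters only for \<open>e = 0\<close>, where it is \<open>1\<close>; including it makes the recurrence
  over the exponents uniform.
\<close>

definition alternating_power_sum :: "nat \<Rightarrow> nat \<Rightarrow> int" where
  "alternating_power_sum N e = (\<Sum>n<N. (-1) ^ n * int n ^ e)"

lemma alternating_power_sum_pos:
  "0 < e \<Longrightarrow> alternating_power_sum N e = (\<Sum>n=1..<N. (-1) ^ n * int n ^ e)"
  unfolding alternating_power_sum_def
  by (intro sum.mono_neutral_right) (auto simp: not_less_eq_eq)

text \<open>
  The power sums pick a single coefficient from the values of a polynomial: multiplying the value
  at \<open>a\<close> by \<open>a\<^sup>p\<^sup>-\<^sup>1\<^sup>-\<^sup>k\<close> and summing over the nonzero residues \<open>a\<close> leaves minus the coefficient of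
  \<open>x\<^sup>k\<close>. Here the values are \<open>(- 1)\<^sup>a\<close>.
\<close>

lemma chain_sum_cong_alternating_power_sum:
  fixes p k :: nat and f :: "nat \<Rightarrow> int"
  assumes "prime p" "odd p" "0 < k" "k < p - 1"
  assumes f: "\<And>n. 0 < n \<Longrightarrow> n < p \<Longrightarrow> [int n * f n = 2] (mod int p)"
  shows "[chain_sum f p k = - alternating_power_sum p (p - 1 - k)] (mod int p)"
proof -
  define e where "e = p - 1 - k"
  have "[(\<Sum>a=1..<p. (\<Sum>d<p. chain_sum f p d * int a ^ d) * int a ^ e) =
         (\<Sum>a=1..<p. (-1) ^ a * int a ^ e)] (mod int p)"
    by (intro cong_sum cong_mult cong_refl chain_sum_generating_function_cong assms) auto
  moreover have "(\<Sum>a=1..<p. (-1) ^ a * int a ^ e) = alternating_power_sum p e"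
    using assms(4) by (intro alternating_power_sum_pos[symmetric]) (simp add: e_def)
  moreover have "(\<Sum>a=1..<p. (\<Sum>d<p. chain_sum f p d * int a ^ d) * int a ^ e) =
                   (\<Sum>d<p. chain_sum f p d * (\<Sum>a=1..<p. int a ^ (d + e)))"
    by (simp add: sum_distrib_left sum_distrib_right power_add mult.assoc sum.swap[of _ "{..<p}"])
  moreover have "[(\<Sum>d<p. chain_sum f p d * (\<Sum>a=1..<p. int a ^ (d + e))) =
                  (\<Sum>d<p. chain_sum f p d * (if d + e = p - 1 then -1 else 0))] (mod int p)"
    using assms(3,4)
    by (intro cong_sum cong_mult cong_refl power_sum_cong[OF assms(1)]) (auto simp: e_def)
  moreover have "(\<Sum>d<p. chain_sum f p d * (if d + e = p - 1 then -1 else 0)) =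
                 (\<Sum>d<p. if d = k then - chain_sum f p d else 0)"
    using assms(3,4) by (intro sum.cong refl) (auto simp: e_def)
  moreover have "\<dots> = - chain_sum f p k"
    using assms(4) by simp
  ultimately have "[- chain_sum f p k = alternating_power_sum p e] (mod int p)"
    by (metis cong_sym cong_trans)
  thus ?thesis
    unfolding e_def by (metis cong_minus_minus_iff minus_minus)
qed

lemma prod_list_map_divide:
  "prod_list (map (\<lambda>n. c / f n) ns) = c ^ length ns / prod_list (map f ns)" for c :: "'a :: field"
  by (induction ns) simp_all

lemma T_sum_eq_chain_sum:
  "(\<Sum>ns\<in>T_indices p (length (replicate k 1)). 2 ^ length (replicate k 1) /
      (\<Prod>i<length (replicate k 1). of_nat (ns ! i) ^ (replicate k 1 ! i))) =
   chain_sum (\<lambda>n. 2 / of_nat n :: rat) p k"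
proof -
  have "2 ^ k / (\<Prod>i<k. of_nat (ns ! i) ^ (replicate k 1 ! i)) =
          prod_list (map (\<lambda>n. 2 / of_nat n :: rat) ns)" if "ns \<in> T_indices p k" for ns
  proof -
    have len: "length ns = k"
      using that by (simp add: T_indices_def)
    have "prod_list (map of_nat ns) = (\<Prod>i<k. of_nat (ns ! i) :: rat)"
      using prod.list_conv_set_nth[of "map of_nat ns"] len by (simp add: lessThan_atLeast0)
    thus ?thesis
      using len by (simp add: prod_list_map_divide)
  qed
  thus ?thesis
    by (simp add: chain_sum_def)
qed

lemma reduces_to_T_sum:
  assumes "prime p" "odd p" "0 < k" "k < p - 1"
  shows   "reduces_to p (chain_sum (\<lambda>n. 2 / of_nat n) p k) (- alternating_power_sum p (p - 1 - k))"
proof -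
  \<comment> \<open>an integer representing \<open>2 / n\<close> modulo \<open>p\<close>\<close>
  define f where "f n = 2 * int n ^ (p - 2)" for n
  have f: "[int n * f n = 2] (mod int p)" if "0 < n" "n < p" for n
    using cong_mult[OF cong_refl power_inverse_cong[OF assms(1) that, of 1], of 2] assms(4)
    by (simp add: f_def mult_ac numeral_2_eq_2)
  have "reduces_to p (chain_sum (\<lambda>n. 2 / of_nat n) p k) (chain_sum f p k)"
    unfolding chain_sum_def
  proof (intro reduces_to_sum reduces_to_prod_list assms(1))
    fix ns n assume "ns \<in> T_indices p k" "n \<in> set ns"
    hence n: "0 < n" "n < p"
      by (auto simp: T_indices_def)
    have "reduces_to p (of_int 2 / of_int (int n)) (f n)"
      by (rule reduces_to_divide[OF assms(1) reduces_to_of_int[OF assms(1) cong_refl]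
            not_dvd_of_less[OF n] f[OF n]])
    thus "reduces_to p (2 / of_nat n) (f n)"
      by simp
  qed
  thus ?thesis
    by (rule reduces_to_cong) (rule chain_sum_cong_alternating_power_sum[OF assms f])
qed

lemma reduces_to_alternating_sum:
  assumes "prime p" "k + 1 < p"
  shows   "reduces_to p (\<Sum>n=1..p-1. (-1) ^ n / of_nat n ^ k) (alternating_power_sum p (p - 1 - k))"
proof -
  have "reduces_to p (\<Sum>n=1..<p. (-1) ^ n / of_nat n ^ k) (\<Sum>n=1..<p. (-1) ^ n * int n ^ (p - 1 - k))"
  proof (intro reduces_to_sum[OF assms(1)])
    fix n assume n: "n \<in> {1..<p}"
    have "[int n ^ k * ((-1) ^ n * int n ^ (p - 1 - k)) = (-1) ^ n * 1] (mod int p)"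
      using cong_mult[OF cong_refl power_inverse_cong[OF assms(1), of n k], of "(-1) ^ n"] n assms(2)
      by (simp add: mult_ac)
    moreover have "\<not> int p dvd int n ^ k"
      using n by (intro not_dvd_power assms(1) not_dvd_of_less) auto
    ultimately have "reduces_to p (of_int ((-1) ^ n) / of_int (int n ^ k)) ((-1) ^ n * int n ^ (p - 1 - k))"
      by (intro reduces_to_divide[OF assms(1) reduces_to_of_int[OF assms(1) cong_refl]]) auto
    thus "reduces_to p ((-1) ^ n / of_nat n ^ k) ((-1) ^ n * int n ^ (p - 1 - k))"
      by simp
  qed
  moreover have "{1..p-1} = {1..<p}"
    using assms(2) by auto
  ultimately show ?thesis
    using assms(2) by (simp add: alternating_power_sum_pos)
qed


section \<open>Even exponents and the Fermat quotient\<close>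

text \<open>
  As \<open>e\<close> is even and \<open>p\<close> is odd, the substitution \<open>n \<mapsto> p - n\<close> preserves \<open>n\<^sup>e\<close> modulo \<open>p\<close> and
  reverses the sign \<open>(- 1)\<^sup>n\<close>.
\<close>

lemma alternating_power_sum_even_cong_0:
  assumes "prime p" "odd p" "even e" "0 < e"
  shows   "[alternating_power_sum p e = 0] (mod int p)"
proof -
  define S where "S = (\<Sum>n=1..<p. (-1) ^ n * int n ^ e)"
  have "S = (\<Sum>n=1..<p. (-1) ^ (p - n) * int (p - n) ^ e)"
    unfolding S_def by (subst sum.atLeastLessThan_rev) simp
  also have "[\<dots> = (\<Sum>n=1..<p. - ((-1) ^ n * int n ^ e))] (mod int p)"
  proof (intro cong_sum)
    fix n assume n: "n \<in> {1..<p}"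
    have "[int (p - n) = - int n] (mod int p)"
      using n by (simp add: cong_iff_dvd_diff of_nat_diff)
    hence "[int (p - n) ^ e = int n ^ e] (mod int p)"
      using cong_pow[of "int (p - n)" "- int n" "int p" e] assms(3) by simp
    hence "[- ((-1) ^ n) * int (p - n) ^ e = - ((-1) ^ n) * int n ^ e] (mod int p)"
      by (intro cong_mult cong_refl)
    moreover have "(-1) ^ (p - n) = (- ((-1) ^ n) :: int)"
      using n assms(2) by (auto simp: minus_one_power_iff)
    ultimately show "[(-1) ^ (p - n) * int (p - n) ^ e = - ((-1) ^ n * int n ^ e)] (mod int p)"
      by (simp only: mult_minus_left)
  qed
  also have "(\<Sum>n=1..<p. - ((-1) ^ n * int n ^ e)) = - S"
    by (simp add: S_def sum_negf)
  finally have "int p dvd 2 * S"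
    by (simp add: cong_iff_dvd_diff)
  moreover have "\<not> int p dvd 2"
    by (rule not_dvd_2[OF assms(1,2)])
  ultimately show ?thesis
    using assms(1,4) by (simp add: prime_dvd_mult_iff cong_0_iff S_def alternating_power_sum_pos)
qed

text \<open>
  By Pascal's rule two neighbouring entries add up to some \<open>p choose (j + 1)\<close>, a multiple of \<open>p\<close>.
\<close>

lemma choose_prime_minus_1_cong:
  assumes "prime p" "j < p"
  shows   "[int ((p - 1) choose j) = (-1) ^ j] (mod int p)"
  using assms(2)
proof (induction j)
  case (Suc j)
  have "p dvd p choose Suc j"
    using Suc.prems assms(1) by (intro dvd_choose_prime) auto
  hence "[int (p choose Suc j) = 0] (mod int p)"
    by (simp add: cong_0_iff)
  moreover have "int (p choose Suc j) = int ((p - 1) choose j) + int ((p - 1) choose Suc j)"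
    using Suc.prems by (cases p) auto
  ultimately have "[int ((p - 1) choose j) + int ((p - 1) choose Suc j) - int ((p - 1) choose j) =
                      0 - (-1) ^ j] (mod int p)"
    using Suc by (intro cong_diff) auto
  thus ?case
    by simp
qed simp

text \<open>
  Expand \<open>2\<^sup>p - 2\<close> into the binomial coefficients \<open>p choose n\<close> with \<open>0 < n < p\<close> and divide by \<open>p\<close>.
  Since \<open>n (p choose n) = p ((p - 1) choose (n - 1))\<close>, the quotient \<open>(p choose n) / p\<close> is congruent
  to \<open>(- 1)\<^sup>n\<^sup>-\<^sup>1 / n\<close>.
\<close>

lemma fermat_quotient_2_cong:
  assumes "prime p" "odd p" "int p * q = 2 ^ (p - 1) - 1"
  shows   "[2 * q = - alternating_power_sum p (p - 2)] (mod int p)"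
proof -
  have p2: "p > 2"
    using assms(1,2) prime_ge_2_nat[of p] by (cases "p = 2") auto
  define c where "c n = (p choose n) div p" for n
  have c: "p choose n = p * c n" if "n \<in> {1..<p}" for n
    using dvd_choose_prime[of n p] that assms(1) by (auto simp: c_def)
  have c_cong: "[int (c n) = - ((-1) ^ n * int n ^ (p - 2))] (mod int p)" if n: "n \<in> {1..<p}" for n
  proof -
    have "n * (p choose n) = p * ((p - 1) choose (n - 1))"
      using times_binomial_minus1_eq[of n p] n by simp
    hence "p * (n * c n) = p * ((p - 1) choose (n - 1))"
      by (simp only: c[OF n] mult.left_commute)
    hence "n * c n = (p - 1) choose (n - 1)"
      using p2 by simp
    hence "[int n * int (c n) = (-1) ^ (n - 1)] (mod int p)"
      using choose_prime_minus_1_cong[OF assms(1) less_imp_diff_less[of n p 1]] n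
      by (simp flip: of_nat_mult)
    hence "[int n ^ (p - 2) * (int n * int (c n)) = int n ^ (p - 2) * (-1) ^ (n - 1)] (mod int p)"
      by (intro cong_mult cong_refl)
    moreover have "[(int n ^ 1 * int n ^ (p - 1 - 1)) * int (c n) = 1 * int (c n)] (mod int p)"
      using n p2 by (intro cong_mult cong_refl power_inverse_cong[OF assms(1)]) auto
    moreover have "(-1) ^ (n - 1) = (- ((-1) ^ n) :: int)"
      using n by (cases n) auto
    ultimately show ?thesis
      by (simp add: mult_ac numeral_2_eq_2) (meson cong_sym cong_trans)
  qed
  have "{..p} = insert 0 (insert p {1..<p})"
    by auto
  hence "int (2 ^ p) = 2 + (\<Sum>n=1..<p. int (p choose n))"
    using p2 by (simp add: choose_row_sum[symmetric])
  also have "(\<Sum>n=1..<p. int (p choose n)) = int p * (\<Sum>n=1..<p. int (c n))"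
    unfolding sum_distrib_left using c by (intro sum.cong) auto
  finally have "2 * (int p * q) = int p * (\<Sum>n=1..<p. int (c n))"
    using p2 unfolding assms(3) by (cases p) auto
  hence "2 * q = (\<Sum>n=1..<p. int (c n))"
    using p2 by simp
  also have "[\<dots> = (\<Sum>n=1..<p. - ((-1) ^ n * int n ^ (p - 2)))] (mod int p)"
    by (intro cong_sum c_cong)
  finally show ?thesis
    using p2 by (simp add: sum_negf alternating_power_sum_pos)
qed


section \<open>Bernoulli numbers modulo a prime\<close>

lemma bernoulli_rec:
  "(\<Sum>j\<le>m. of_nat (Suc m choose j) * bernoulli j) = (if m = 0 then 1 else 0)"
proof -
  have "fps_nth (Abs_fps (\<lambda>n. bernoulli n / fact n) * (fps_exp 1 - 1)) (Suc m) = fps_nth fps_X (Suc m)"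
    unfolding bernoulli_egf ..
  hence "(\<Sum>j\<le>m. bernoulli j / fact j * (1 / fact (Suc m - j))) = (if m = 0 then 1 else 0)"
    by (simp add: fps_mult_nth atLeast0AtMost, simp add: mult_ac split: if_splits)
  hence "fact (Suc m) * (\<Sum>j\<le>m. bernoulli j / fact j * (1 / fact (Suc m - j))) = (if m = 0 then 1 else 0)"
    by simp
  moreover have "fact (Suc m) * (bernoulli j / fact j * (1 / fact (Suc m - j))) = 
      of_nat (Suc m choose j) * bernoulli j" if "j \<le> m" for j
    using that by (simp add: binomial_fact del: fact_Suc)
  ultimately show ?thesis
    by (simp add: sum_distrib_left del: fact_Suc)
qed

text \<open>
  The recurrence expresses \<open>(m + 1) B\<^sub>m\<close> as an integral combination of earlier Bernoulli numbers;
  while \<open>m + 1 < p\<close>, division by \<open>m + 1\<close> brings no factor \<open>p\<close> into the denominator.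
\<close>

lemma reduces_to_bernoulli:
  assumes "prime p" "m < p - 1"
  shows   "\<exists>z. reduces_to p (bernoulli m) z"
  using assms(2)
proof (induction m rule: less_induct)
  case (less m)
  define z where "z j = (SOME z. reduces_to p (bernoulli j) z)" for j
  have z: "reduces_to p (bernoulli j) (z j)" if "j < m" for j
    using less that unfolding z_def by (metis less_trans someI_ex)
  define s :: rat where "s = of_int (if m = 0 then 1 else 0) + - (\<Sum>j<m. of_int (int (Suc m choose j)) * bernoulli j)"
  define w where "w = (if m = 0 then 1 else 0) + - (\<Sum>j<m. int (Suc m choose j) * z j)"
  have w: "reduces_to p s w"
    unfolding s_def w_def
    by (intro reduces_to_add reduces_to_minus reduces_to_sum reduces_to_mult assms(1)
          reduces_to_of_int[OF _ cong_refl] z) auto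
  have "of_nat (Suc m) * bernoulli m = s"
    using bernoulli_rec[of m] by (simp add: s_def lessThan_Suc_atMost[symmetric] algebra_simps split: if_splits)
  hence eq: "bernoulli m = s / of_int (int (Suc m))"
    by (simp add: field_simps)
  have nd: "\<not> int p dvd int (Suc m)"
    using less.prems by (intro not_dvd_of_less) auto
  have "[int (Suc m) * (int (Suc m) ^ (p - 2) * w) = w] (mod int p)"
    using cong_mult[OF power_inverse_cong[OF assms(1), of "Suc m" 1] cong_refl, of w] less.prems
    by (simp add: mult_ac numeral_2_eq_2)
  hence "reduces_to p (bernoulli m) (int (Suc m) ^ (p - 2) * w)"
    unfolding eq by (intro reduces_to_divide[OF assms(1) w nd])
  thus ?case ..
qed

text \<open>
  The numbers with exponential generating function \<open>2 / (e\<^sup>t + 1)\<close>, that is, the values at \<open>0\<close> of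
  the Euler polynomials.
\<close>

definition euler_coeff :: "nat \<Rightarrow> rat" where
  "euler_coeff e = 2 * (1 - 2 ^ Suc e) * bernoulli (Suc e) / of_nat (Suc e)"

text \<open>
  If \<open>b(t) = t / (e\<^sup>t - 1)\<close>, then \<open>b(t) - b(2t) = t / (e\<^sup>t + 1)\<close>, since
  \<open>e\<^sup>2\<^sup>t - 1 = (e\<^sup>t - 1) (e\<^sup>t + 1)\<close>. The recurrence compares coefficients after
  multiplication by \<open>e\<^sup>t + 1\<close>.
\<close>

lemma euler_coeff_rec:
  "euler_coeff e + (\<Sum>j\<le>e. of_nat (e choose j) * euler_coeff j) = (if e = 0 then 2 else 0)"
proof -
  define b where "b = Abs_fps (\<lambda>n. bernoulli n / fact n)"
  define b2 where "b2 = b oo (fps_const 2 * fps_X)"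
  let ?E = "fps_exp 1 :: rat fps"
  have "(b * (?E - 1)) oo (fps_const 2 * fps_X) = fps_X oo (fps_const 2 * fps_X)"
    by (simp add: b_def bernoulli_egf)
  hence b2: "b2 * (fps_exp 2 - 1) = fps_const 2 * fps_X"
    by (simp add: b2_def fps_compose_mult_distrib fps_compose_sub_distrib fps_exp_compose_linear)
  have E2: "fps_exp 2 = ?E * ?E"
    by (simp flip: fps_exp_add_mult)
  have "(b - b2) * (?E + 1) * (?E - 1) = (b * (?E - 1)) * (?E + 1) - b2 * (?E * ?E - 1)"
    by (simp add: algebra_simps)
  also have "\<dots> = fps_X * (?E - 1)"
    unfolding E2[symmetric] b2 using bernoulli_egf 
    by (simp add: b_def algebra_simps fps_numeral_fps_const flip: mult_2)
  finally have "(b - b2) * (?E + 1) * (?E - 1) = fps_X * (?E - 1)" .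
  moreover have "?E - 1 \<noteq> 0"
  proof
    assume "?E - 1 = 0"
    hence "fps_nth (?E - 1) 1 = 0"
      by (simp only: fps_zero_nth)
    thus False
      by simp
  qed
  ultimately have eq: "(b - b2) * (?E + 1) = fps_X"
    by simp
  have nth: "fps_nth (b - b2) (Suc j) = euler_coeff j / (2 * fact j)" for j
    unfolding b2_def fps_compose_linear
    by (simp add: b_def euler_coeff_def divide_simps) (simp add: algebra_simps)
  have nth0: "fps_nth b2 0 = fps_nth b 0"
    unfolding b2_def fps_compose_linear by (simp add: b_def)
  have "fps_nth ((b - b2) * (?E + 1)) (Suc e) =
         (\<Sum>j\<le>e. fps_nth (b - b2) (Suc j) * fps_nth (?E + 1) (e - j))"
    unfolding fps_mult_nth atLeast0AtMost by (subst sum.atMost_Suc_shift) (simp add: nth0)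
  also have "\<dots> = (\<Sum>j\<le>e. euler_coeff j / (2 * fact j) * (1 / fact (e - j) + (if j = e then 1 else 0)))"
    unfolding nth by (intro sum.cong) auto
  also have "\<dots> = (\<Sum>j\<le>e. euler_coeff j / (2 * fact j) * (1 / fact (e - j)) +
                     (if j = e then euler_coeff j / (2 * fact j) else 0))"
    by (intro sum.cong) (auto simp: algebra_simps)
  also have "\<dots> = (\<Sum>j\<le>e. euler_coeff j / (2 * fact j) * (1 / fact (e - j))) + euler_coeff e / (2 * fact e)"
    by (simp add: sum.distrib)
  finally have "(\<Sum>j\<le>e. euler_coeff j / (2 * fact j) * (1 / fact (e - j))) + euler_coeff e / (2 * fact e)
                  = (if e = 0 then 1 else 0)"
    unfolding eq by simp
  hence "2 * fact e * ((\<Sum>j\<le>e. euler_coeff j / (2 * fact j) * (1 / fact (e - j))) + euler_coeff e / (2 * fact e))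
                  = (if e = 0 then 2 else 0)"
    by simp
  moreover have "2 * fact e * (euler_coeff j / (2 * fact j) * (1 / fact (e - j))) =
                   of_nat (e choose j) * euler_coeff j" if "j \<le> e" for j
    using that by (simp add: binomial_fact)
  ultimately show ?thesis
    by (simp add: distrib_left sum_distrib_left)
qed

text \<open>
  Again the sum telescopes: the term for \<open>n\<close> is \<open>(- 1)\<^sup>n (n\<^sup>e + (n + 1)\<^sup>e)\<close>.
\<close>

lemma alternating_power_sum_rec:
  assumes "odd N"
  shows "alternating_power_sum N e + (\<Sum>j\<le>e. int (e choose j) * alternating_power_sum N j) =
           0 ^ e + int N ^ e"
proof -
  have "(\<Sum>j\<le>e. int (e choose j) * alternating_power_sum N j) =
          (\<Sum>n<N. (-1) ^ n * (\<Sum>j\<le>e. int (e choose j) * int n ^ j))"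
    unfolding alternating_power_sum_def
    by (simp only: sum_distrib_left sum.swap[of _ "{..e}"] mult.left_commute)
  also have "\<dots> = (\<Sum>n<N. (-1) ^ n * int (Suc n) ^ e)"
  proof (intro sum.cong refl)
    fix n
    have "int (Suc n) ^ e = (int n + 1) ^ e"
      by (simp add: add.commute)
    also have "\<dots> = (\<Sum>j\<le>e. int (e choose j) * int n ^ j)"
      unfolding binomial_ring by simp
    finally show "(-1) ^ n * (\<Sum>j\<le>e. int (e choose j) * int n ^ j) = (-1) ^ n * int (Suc n) ^ e"
      by simp
  qed
  finally have "alternating_power_sum N e + (\<Sum>j\<le>e. int (e choose j) * alternating_power_sum N j) =
      - (\<Sum>n<N. (-1) ^ Suc n * int (Suc n) ^ e - (-1) ^ n * int n ^ e)"
    by (simp add: alternating_power_sum_def sum_subtractf sum_negf)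
  also have "(\<Sum>n<N. (-1) ^ Suc n * int (Suc n) ^ e - (-1) ^ n * int n ^ e) =
               (-1) ^ N * int N ^ e - (-1) ^ 0 * int 0 ^ e"
    by (rule sum_lessThan_telescope)
  finally show ?thesis
    using assms by simp
qed

text \<open>
  Modulo \<open>p\<close> both sequences satisfy the same recurrence, in which the current term appears with
  coefficient \<open>2\<close>, an invertible residue.
\<close>

lemma reduces_to_euler_coeff:
  assumes "prime p" "odd p"
  shows   "reduces_to p (euler_coeff e) (alternating_power_sum p e)"
proof (induction e rule: less_induct)
  case (less e)
  define s :: rat where "s = of_int (if e = 0 then 2 else 0) + - (\<Sum>j<e. of_int (int (e choose j)) * euler_coeff j)"
  define w where "w = (if e = 0 then 2 else 0) + - (\<Sum>j<e. int (e choose j) * alternating_power_sum p j)"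
  have "reduces_to p s w"
    unfolding s_def w_def
    by (intro reduces_to_add reduces_to_minus reduces_to_sum reduces_to_mult assms(1)
          reduces_to_of_int[OF _ cong_refl] less) auto
  moreover have "euler_coeff e = s / of_int 2"
    using euler_coeff_rec[of e] by (simp add: s_def lessThan_Suc_atMost[symmetric] split: if_splits)
  moreover have "2 * alternating_power_sum p e - w = 0 ^ e + int p ^ e - (if e = 0 then 2 else 0)"
    using alternating_power_sum_rec[OF assms(2), of e]
    by (simp add: w_def lessThan_Suc_atMost[symmetric])
  hence "[2 * alternating_power_sum p e = w] (mod int p)"
    by (cases "e = 0") (auto simp: cong_iff_dvd_diff power_0_left)
  moreover have "\<not> int p dvd 2"
    by (rule not_dvd_2[OF assms(1,2)])
  ultimately show ?case
    using reduces_to_divide[OF assms(1)] by metis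
qed

text \<open>
  By the definition of \<open>euler_coeff\<close> the alternating sum is congruent to \<open>2 (1 - 2\<^sup>m) B\<^sub>m / m\<close> with
  \<open>m = p - k\<close>, and \<open>m\<close> is congruent to \<open>- k\<close>. The integrality of \<open>B\<^sub>m\<close> has to be known beforehand,
  for \<open>1 - 2\<^sup>m\<close> may be divisible by \<open>p\<close>.
\<close>

lemma alternating_power_sum_cong_bernoulli:
  assumes "prime p" "odd p" "1 < k" "k < p"
  shows   "[2 * (1 - 2 ^ (p - k)) * rat_residue p (bernoulli (p - k) / of_nat k) =
             - alternating_power_sum p (p - 1 - k)] (mod int p)"
proof -
  define Z where "Z = alternating_power_sum p (p - 1 - k)"
  define m where "m = p - k"
  define \<beta> where "\<beta> = rat_residue p (bernoulli m / of_nat k)"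
  have m: "Suc (p - 1 - k) = m"
    using assms(4) by (simp add: m_def)
  have nd: "\<not> int p dvd int k"
    using assms(3,4) by (intro not_dvd_of_less) auto
  have "m < p - 1"
    using assms(3,4) by (simp add: m_def)
  obtain b where b: "reduces_to p (bernoulli m) b"
    using reduces_to_bernoulli[OF assms(1) \<open>m < p - 1\<close>] by blast
  have "[int k * (int k ^ (p - 2) * b) = b] (mod int p)"
    using cong_mult[OF power_inverse_cong[OF assms(1), of k 1] cong_refl, of b] assms(3,4)
    by (simp add: mult_ac numeral_2_eq_2)
  hence "reduces_to p (bernoulli m / of_int (int k)) (int k ^ (p - 2) * b)"
    by (intro reduces_to_divide[OF assms(1) b nd])
  hence "[\<beta> = int k ^ (p - 2) * b] (mod int p)"
    unfolding \<beta>_def using rat_residue_reduces_to[OF assms(1)] by simp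
  hence "[int k * \<beta> = int k * (int k ^ (p - 2) * b)] (mod int p)"
    by (intro cong_mult cong_refl)
  hence k\<beta>: "[int k * \<beta> = b] (mod int p)"
    using \<open>[int k * (int k ^ (p - 2) * b) = b] (mod int p)\<close> cong_trans by blast
  have "reduces_to p (of_int (int m) * euler_coeff (p - 1 - k)) (int m * Z)"
    unfolding Z_def
    by (intro reduces_to_mult reduces_to_of_int[OF _ cong_refl] reduces_to_euler_coeff assms(1,2))
  moreover have "of_int (int m) * euler_coeff (p - 1 - k) = of_int (2 * (1 - 2 ^ m)) * bernoulli m"
    using assms(4) unfolding euler_coeff_def m by (simp add: m_def)
  moreover have "reduces_to p (of_int (2 * (1 - 2 ^ m)) * bernoulli m) (2 * (1 - 2 ^ m) * b)"
    by (intro reduces_to_mult reduces_to_of_int[OF _ cong_refl] b assms(1))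
  ultimately have "[2 * (1 - 2 ^ m) * b = int m * Z] (mod int p)"
    using reduces_to_unique[OF assms(1)] by metis
  also have "[int m * Z = - int k * Z] (mod int p)"
    using assms(4) by (intro cong_mult cong_refl) (simp add: m_def cong_iff_dvd_diff)
  finally have "[2 * (1 - 2 ^ m) * b = - int k * Z] (mod int p)" .
  moreover have "[2 * (1 - 2 ^ m) * (int k * \<beta>) = 2 * (1 - 2 ^ m) * b] (mod int p)"
    by (intro cong_mult cong_refl k\<beta>)
  ultimately have "[int k * (2 * (1 - 2 ^ m) * \<beta>) = int k * (- Z)] (mod int p)"
    using cong_trans by (fastforce simp: mult_ac)
  moreover have "coprime (int k) (int p)"
    using nd assms(1) prime_imp_coprime[of "int p" "int k"] by (simp add: coprime_commute)
  ultimately have "[2 * (1 - 2 ^ m) * \<beta> = - Z] (mod int p)"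
    using cong_mult_lcancel by blast
  thus ?thesis
    unfolding Z_def \<beta>_def m_def .
qed


section \<open>Identities in the ring of residues modulo almost all primes\<close>

lemma T_adele_ones_eq:
  assumes "0 < k"
  shows "T_adele (replicate k 1) = abs_adele (\<lambda>p. - alternating_power_sum p (p - 1 - k))"
  unfolding T_adele_def T_sum_eq_chain_sum
proof (rule adele_of_seq_eq_abs_adele[of "k + 2"])
  fix p assume p: "prime p" "k + 2 < p"
  hence "odd p"
    by (intro prime_odd_nat) auto
  thus "reduces_to p (chain_sum (\<lambda>n. 2 / of_nat n) p k) (- alternating_power_sum p (p - 1 - k))"
    using p assms by (intro reduces_to_T_sum) auto
qed

lemma zeta_bar_adele_eq:
  "zeta_bar_adele k = abs_adele (\<lambda>p. alternating_power_sum p (p - 1 - k))"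
  unfolding zeta_bar_adele_def
  by (rule adele_of_seq_eq_abs_adele, rule reduces_to_alternating_sum)

lemma zeta_bar_adele_even:
  assumes "even k"
  shows   "zeta_bar_adele k = 0"
  unfolding zeta_bar_adele_eq zero_adele_def
proof (rule abs_adele_eqI[of "k + 2"])
  fix p assume p: "prime p" "k + 2 < p"
  hence "odd p"
    by (intro prime_odd_nat) auto
  thus "[alternating_power_sum p (p - 1 - k) = 0] (mod int p)"
    using p assms by (intro alternating_power_sum_even_cong_0) auto
qed

lemma fermat_quotient_2_adele_eq:
  "2 * fermat_quotient_2 = - zeta_bar_adele 1"
proof -
  define q where "q p = (2 ^ (p - 1) - 1) div int p" for p
  have q: "int p * q p = 2 ^ (p - 1) - 1" if "prime p" "p > 2" for p
  proof -
    have "\<not> int p dvd int 2"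
      using that by (intro not_dvd_of_less) auto
    hence "int p dvd 2 ^ (p - 1) - 1"
      using fermat_int[OF that(1), of 2] by (simp add: cong_iff_dvd_diff)
    thus ?thesis
      by (simp add: q_def)
  qed
  have fq: "fermat_quotient_2 = abs_adele q"
    unfolding fermat_quotient_2_def
  proof (rule adele_of_seq_eq_abs_adele[of 2])
    fix p :: nat assume p: "prime p" "p > 2"
    have "rat_of_int (int p * q p) = 2 ^ (p - 1) - 1"
      unfolding q[OF p] by simp
    hence "(2 ^ (p - 1) - 1) / of_nat p = rat_of_int (q p)"
      using p(2) by (simp add: field_simps)
    thus "reduces_to p (if p > 2 then (2 ^ (p - 1) - 1) / of_nat p else 0) (q p)"
      using p reduces_to_of_int[OF p(1) cong_refl] by simp
  qed
  have "2 * fermat_quotient_2 = abs_adele (\<lambda>p. (1 + 1) * q p)"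
    unfolding one_add_one[symmetric, where ?'a = adele] fq
    by (simp only: one_adele_def plus_adele.abs_eq times_adele.abs_eq)
  also have "\<dots> = abs_adele (\<lambda>p. - alternating_power_sum p (p - 1 - 1))"
    by (rule abs_adele_eqI[of 2])
       (use fermat_quotient_2_cong[OF _ prime_odd_nat q] in \<open>auto simp: numeral_2_eq_2\<close>)
  finally show ?thesis
    by (simp add: zeta_bar_adele_eq uminus_adele.abs_eq)
qed

text \<open>
  Fermat's theorem makes \<open>2\<^sup>p\<^sup>-\<^sup>k\<close> a representative of \<open>2\<^sup>1\<^sup>-\<^sup>k\<close> modulo every odd prime \<open>p > k\<close>.
\<close>

lemma zeta_bar_adele_bernoulli:
  assumes "1 < k"
  shows   "adele_of_rat (2 * (1 - 2 powi (1 - int k))) * bernoulli_adele k = - zeta_bar_adele k"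
proof -
  have "adele_of_rat (2 * (1 - 2 powi (1 - int k))) = abs_adele (\<lambda>p. 2 * (1 + - (2 ^ (p - k))))"
    unfolding adele_of_rat_def
  proof (rule adele_of_seq_eq_abs_adele[of "k + 1"])
    fix p assume p: "prime p" "k + 1 < p"
    have "\<not> int p dvd int 2"
      using p assms by (intro not_dvd_of_less) auto
    hence nd: "\<not> int p dvd 2"
      by simp
    have "(k - 1) + (p - k) = p - 1"
      using p assms by simp
    hence "[2 ^ (k - 1) * 2 ^ (p - k) = 1] (mod int p)"
      using fermat_int[OF p(1) nd] by (simp flip: power_add)
    moreover have "\<not> int p dvd 2 ^ (k - 1)"
      by (rule not_dvd_power[OF p(1) nd])
    ultimately have "reduces_to p (of_int 1 / of_int (2 ^ (k - 1))) (2 ^ (p - k))"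
      by (intro reduces_to_divide[OF p(1) reduces_to_of_int[OF p(1) cong_refl]])
    hence "reduces_to p (of_int 2 * (of_int 1 + - (of_int 1 / of_int (2 ^ (k - 1))))) (2 * (1 + - (2 ^ (p - k))))"
      by (intro reduces_to_mult reduces_to_add reduces_to_minus reduces_to_of_int[OF _ cong_refl] p(1))
    moreover have "(2 :: rat) powi (1 - int k) = 1 / 2 ^ (k - 1)"
      using assms by (simp add: power_int_def nat_diff_distrib' field_simps)
    ultimately show "reduces_to p (2 * (1 - 2 powi (1 - int k))) (2 * (1 + - (2 ^ (p - k))))"
      by simp
  qed
  hence "adele_of_rat (2 * (1 - 2 powi (1 - int k))) * bernoulli_adele k =
           abs_adele (\<lambda>p. 2 * (1 + - (2 ^ (p - k))) *
             rat_residue p (if p > k then bernoulli (p - k) / of_nat k else 0))"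
    by (simp only: bernoulli_adele_def adele_of_seq_def times_adele.abs_eq)
  also have "\<dots> = abs_adele (\<lambda>p. - alternating_power_sum p (p - 1 - k))"
    by (rule abs_adele_eqI[of "k + 2"])
       (use assms alternating_power_sum_cong_bernoulli[OF _ prime_odd_nat] in auto)
  finally show ?thesis
    by (simp add: zeta_bar_adele_eq uminus_adele.abs_eq)
qed

theorem theorem2p5:
  fixes k :: nat
  assumes "k > 0"
  shows "T_adele (replicate k 1) = - zeta_bar_adele k \<and>
         - zeta_bar_adele k =
           (if even k then 0
            else if k = 1 then 2 * fermat_quotient_2
            else adele_of_rat (2 * (1 - 2 powi (1 - int k))) * bernoulli_adele k)"
proof
  show "T_adele (replicate k 1) = - zeta_bar_adele k"
    unfolding T_adele_ones_eq[OF assms] zeta_bar_adele_eq uminus_adele.abs_eq ..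
  show "- zeta_bar_adele k =
           (if even k then 0
            else if k = 1 then 2 * fermat_quotient_2
            else adele_of_rat (2 * (1 - 2 powi (1 - int k))) * bernoulli_adele k)"
    using assms fermat_quotient_2_adele_eq zeta_bar_adele_even[of k] zeta_bar_adele_bernoulli[of k]
    by (cases "k = 1") simp_all
qed

end
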